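(* Let $\mathbb{K}$ be a field and let $\mathbf{M}\in\mathbb{K}^{n\times n}$ be a diagonalizable matrix with characteristic polynomial $\varphi_{\mathbf{M}}$. Let $\mathbf{U}$ be the eigenvector matrix of $\mathbf{M}$. If $\operatorname{Gal}(\varphi_{\mathbf{M}})\ge A_n$, then all minors of $\mathbf{U}$ are nonzero, i.e. $\det(\mathbf{U}_{W,S})\neq 0$ for every $1\le m\le n$ and all subsets $W,S\subseteq\{1,\dots,n\}$ with $|W|=|S|=m$.
   Context: Let $\mathbb{L}$ be the splitting field of $\varphi_{\mathbf{M}}$ over $\mathbb{K}$; diagonalizable means diagonalizable over $\mathbb{L}$. Let $\lambda_1,\dots,\lambda_n\in\mathbb{L}$ be the eigenvalues of $\mathbf{M}$. The eigenvector matrix $\mathbf{U}$ of $\mathbf{M}$ is the matrix whose columns $u_1,\dots,u_n\in\mathbb{L}^n$ form a basis of eigenvectors, $\mathbf{M}u_i=\lambda_iu_i$. $\operatorname{Gal}(\varphi_{\mathbf{M}})=\operatorname{Aut}_{\mathbb{K}}(\mathbb{L})$ is viewed as a group of permutations of the roots, i.e. as a subgroup of $\operatorname{Sym}(\{\lambda_1,\dots,\lambda_n\})\cong S_n$ (the $n$ roots being pairwise distinct), and $\operatorname{Gal}(\varphi_{\mathbf{M}})\ge A_n$ means that this permutation group contains the alternating group $A_n$. $\mathbf{U}_{W,S}$ is the submatrix of $\mathbf{U}$ with rows indexed by $W$ and columns indexed by $S$.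
   Formalization: For n = 2 the Galois group is required to be the full S_2, since A_2 is trivial and the claim fails for distinct eigenvalues in K (M = diag(1,2) over Q, U the identity, has zero 1×1 minors); all other n are unchanged. *)

theory Defs
  imports
    "Jordan_Normal_Form.Char_Poly"
    "Jordan_Normal_Form.VS_Connect"
    "Jordan_Normal_Form.DL_Submatrix"
    "HOL-Algebra.Generated_Fields"
    "HOL-Combinatorics.Orbits"
begin

text \<open>
  A field extension is a homomorphism \<open>h\<close> from a field type \<open>'k\<close> to a field type \<open>'l\<close>,
  which identifies \<open>'k\<close> with the subfield \<open>range h\<close> of \<open>'l\<close>.
\<close>

definition roots_in :: "('k::field \<Rightarrow> 'l::field) \<Rightarrow> 'k poly \<Rightarrow> 'l set" where
  "roots_in h p = {x. poly (map_poly h p) x = 0}"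

definition is_splitting_field :: "('k::field \<Rightarrow> 'l::field) \<Rightarrow> 'k poly \<Rightarrow> bool" where
  "is_splitting_field h p \<longleftrightarrow>
     field_hom h \<and>
     (\<exists>as. map_poly h p = Polynomial.smult (h (lead_coeff p)) (\<Prod>a\<leftarrow>as. [:- a, 1:])) \<and>
     generate_field class_ring (range h \<union> roots_in h p) = UNIV"

definition gal_group :: "('k::field \<Rightarrow> 'l::field) \<Rightarrow> ('l \<Rightarrow> 'l) set" where
  "gal_group h = {\<sigma>. field_hom \<sigma> \<and> bij \<sigma> \<and> (\<forall>k. \<sigma> (h k) = h k)}"

text \<open>
  The Galois group as a group of permutations of the roots of \<open>p\<close>. Following \<open>permutes\<close>,
  a permutation of a set is extended by the identity outside it.
\<close>

definition gal_perms :: "('k::field \<Rightarrow> 'l::field) \<Rightarrow> 'k poly \<Rightarrow> ('l \<Rightarrow> 'l) set" where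
  "gal_perms h p = (\<lambda>\<sigma>. perm_restrict \<sigma> (roots_in h p)) ` gal_group h"

definition sym_perms :: "'a set \<Rightarrow> ('a \<Rightarrow> 'a) set" where
  "sym_perms R = {\<pi>. \<pi> permutes R}"

definition alt_perms :: "'a set \<Rightarrow> ('a \<Rightarrow> 'a) set" where
  "alt_perms R = {\<pi>. \<pi> permutes R \<and> evenperm \<pi>}"

definition diagonalizable_mat :: "'a::field mat \<Rightarrow> bool" where
  "diagonalizable_mat A \<longleftrightarrow> (\<exists>D. diagonal_mat D \<and> similar_mat A D)"

text \<open>
  Eigenvalues, rows and columns are indexed by \<open>{0..<n}\<close>. Distinctness of the columns is
  required separately because \<open>basis\<close> only sees the set of columns.
\<close>

definition eigenvector_matrix ::
    "nat \<Rightarrow> 'a::field mat \<Rightarrow> (nat \<Rightarrow> 'a) \<Rightarrow> 'a mat \<Rightarrow> bool" where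
  "eigenvector_matrix n A ev U \<longleftrightarrow>
     U \<in> carrier_mat n n \<and>
     (\<forall>i<n. eigenvector A (col U i) (ev i)) \<and>
     distinct (cols U) \<and>
     vectorspace.basis class_ring (module_vec TYPE('a) n) (set (cols U))"

end

theory Submission
  imports Defs "Jordan_Normal_Form.DL_Rank"
begin

text \<open>
  Fix a set of rows \<open>W\<close> of size \<open>m\<close>. Since \<open>U\<close> is invertible, its rows in \<open>W\<close> are linearly
  independent, so some set \<open>S\<^sub>0\<close> of \<open>m\<close> columns has \<open>det U\<^bsub>W,S\<^sub>0\<^esub> \<noteq> 0\<close>. The Galois group spreads this
  to all column sets. An automorphism \<open>\<sigma>\<close> fixes the entries of \<open>M\<close>, hence maps an eigenvector for
  \<open>\<lambda>\<close> to an eigenvector for \<open>\<sigma> \<lambda>\<close>; the eigenvalues being distinct, eigenspaces are lines, so \<open>\<sigma>\<close>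
  permutes the columns of \<open>U\<close> up to nonzero scalars, in the way it permutes the eigenvalues.
  Therefore \<open>\<sigma> (det U\<^bsub>W,S\<^esub>)\<close> is a nonzero multiple of \<open>det U\<^bsub>W,\<sigma>S\<^esub>\<close>, and it suffices that the Galois
  group acts transitively on the sets of \<open>m\<close> roots. The alternating group does so for \<open>n \<noteq> 2\<close>: an
  odd permutation carrying \<open>S\<close> to \<open>S\<^sub>0\<close> can be corrected by a transposition that preserves \<open>S\<close>. For
  \<open>n = 2\<close> the alternating group is trivial and the full symmetric group is what acts.

  Reordering columns changes determinants by signs and disturbs the position of an index within a
  submatrix. The argument therefore works with the equivalent condition that the submatrix has
  trivial kernel (\<open>independent_columns\<close>), which makes sense for index sets without an order;
  determinants enter only at the two ends, through \<open>det_submatrix_nonzero\<close> and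
  \<open>eigenvector_matrix_independent\<close>. The three steps are \<open>independent_columns_subset_rows\<close>
  (existence of \<open>S\<^sub>0\<close>), \<open>eigenvectors_same_eigenvalue_proportional\<close> with
  \<open>independent_columns_conjugate\<close> (transport along \<open>\<sigma>\<close>), and \<open>alternating_transitive_on_subsets\<close>.
\<close>

section \<open>Submatrices with trivial kernel\<close>

definition independent_columns :: "('i \<Rightarrow> 'j \<Rightarrow> 'a::field) \<Rightarrow> 'i set \<Rightarrow> 'j set \<Rightarrow> bool" where
  "independent_columns A I J \<longleftrightarrow>
     (\<forall>c. (\<forall>i\<in>I. (\<Sum>j\<in>J. A i j * c j) = 0) \<longrightarrow> (\<forall>j\<in>J. c j = 0))"

lemma independent_columnsI:
  assumes "\<And>c j. (\<And>i. i \<in> I \<Longrightarrow> (\<Sum>j\<in>J. A i j * c j) = 0) \<Longrightarrow> j \<in> J \<Longrightarrow> c j = 0"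
  shows "independent_columns A I J"
  using assms unfolding independent_columns_def by blast

lemma independent_columnsD:
  assumes "independent_columns A I J" "\<And>i. i \<in> I \<Longrightarrow> (\<Sum>j\<in>J. A i j * c j) = 0" "j \<in> J"
  shows "c j = 0"
  using assms unfolding independent_columns_def by blast

text \<open>
  Gaussian elimination: an equation with a nonzero coefficient at \<open>j\<^sub>0\<close> is used to eliminate the
  unknown \<open>j\<^sub>0\<close> from the remaining ones.
\<close>

lemma underdetermined_homogeneous_system:
  fixes A :: "'i \<Rightarrow> 'j \<Rightarrow> 'a::field"
  assumes "finite I" "finite J" "card I < card J"
  shows "\<exists>c. (\<forall>i\<in>I. (\<Sum>j\<in>J. A i j * c j) = 0) \<and> (\<exists>j\<in>J. c j \<noteq> 0)"
  using assms
proof (induction I arbitrary: J A rule: finite_induct)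
  case empty
  then have "J \<noteq> {}" by auto
  then show ?case by (auto intro!: exI[of _ "\<lambda>_. 1"])
next
  case (insert w I)
  show ?case
  proof (cases "\<forall>j\<in>J. A w j = 0")
    case True
    have "card I < card J" using insert by simp
    from insert.IH[OF insert.prems(1) this, of A] True show ?thesis by auto
  next
    case False
    then obtain j0 where j0: "j0 \<in> J" "A w j0 \<noteq> 0" by blast
    define B where "B i j = A i j - A i j0 * A w j / A w j0" for i j
    have "card I < card (J - {j0})" using insert j0 by simp
    then obtain c where c: "\<forall>i\<in>I. (\<Sum>j\<in>J - {j0}. B i j * c j) = 0" "\<exists>j\<in>J - {j0}. c j \<noteq> 0"
      using insert.IH[of "J - {j0}" B] insert.prems(1) by auto
    define t where "t = (\<Sum>j\<in>J - {j0}. A w j * c j)"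
    define c' where "c' = c(j0 := - t / A w j0)"
    have sum: "(\<Sum>j\<in>J. A i j * c' j) = - A i j0 * t / A w j0 + (\<Sum>j\<in>J - {j0}. A i j * c j)" for i
    proof -
      have "(\<Sum>j\<in>J. A i j * c' j) = A i j0 * c' j0 + (\<Sum>j\<in>J - {j0}. A i j * c' j)"
        using j0 insert.prems(1) by (simp add: sum.remove)
      moreover have "(\<Sum>j\<in>J - {j0}. A i j * c' j) = (\<Sum>j\<in>J - {j0}. A i j * c j)"
        by (rule sum.cong) (auto simp: c'_def)
      ultimately show ?thesis by (simp add: c'_def)
    qed
    have "(\<Sum>j\<in>J. A i j * c' j) = 0" if i: "i \<in> insert w I" for i
    proof (cases "i = w")
      case True
      then show ?thesis using sum[of w] j0 by (simp add: t_def)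
    next
      case False
      have "0 = (\<Sum>j\<in>J - {j0}. B i j * c j)" using c(1) i False by simp
      also have "\<dots> = (\<Sum>j\<in>J - {j0}. A i j * c j - A i j0 / A w j0 * (A w j * c j))"
        by (rule sum.cong) (simp_all add: B_def algebra_simps)
      also have "\<dots> = (\<Sum>j\<in>J - {j0}. A i j * c j) - A i j0 / A w j0 * t"
        by (simp add: t_def sum_subtractf sum_distrib_left)
      finally show ?thesis using sum[of i] by simp
    qed
    moreover have "\<exists>j\<in>J. c' j \<noteq> 0" using c(2) by (auto simp: c'_def)
    ultimately show ?thesis by blast
  qed
qed

text \<open>
  The counterpart of Laplace expansion along the row \<open>w\<close>: some cofactor is nonzero. Without the
  row \<open>w\<close> the kernel is a line, spanned by some \<open>x\<close>, and deleting any column \<open>s\<close> in the support of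
  \<open>x\<close> makes it trivial.
\<close>

lemma independent_columns_delete_row:
  assumes fin: "finite I" "finite J" and card: "card I = card J"
    and ind: "independent_columns A I J" and w: "w \<in> I"
  shows "\<exists>s\<in>J. independent_columns A (I - {w}) (J - {s})"
proof -
  have "card (I - {w}) < card J" using fin card w by (metis card_Diff1_less)
  then obtain x where x: "\<forall>i\<in>I - {w}. (\<Sum>j\<in>J. A i j * x j) = 0" "\<exists>j\<in>J. x j \<noteq> 0"
    using underdetermined_homogeneous_system[of "I - {w}" J A] fin by auto
  then obtain s where s: "s \<in> J" "x s \<noteq> 0" by blast
  define b where "b = (\<Sum>j\<in>J. A w j * x j)"
  have b: "b \<noteq> 0"
  proof
    assume "b = 0"
    then have "(\<Sum>j\<in>J. A i j * x j) = 0" if "i \<in> I" for i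
      using x(1) that by (cases "i = w") (auto simp: b_def)
    then show False using independent_columnsD[OF ind _ s(1), of x] s(2) by blast
  qed
  have "independent_columns A (I - {w}) (J - {s})"
  proof (rule independent_columnsI)
    fix y j
    assume y: "\<And>i. i \<in> I - {w} \<Longrightarrow> (\<Sum>j\<in>J - {s}. A i j * y j) = 0" and j: "j \<in> J - {s}"
    define y' where "y' = y(s := 0)"
    have y': "(\<Sum>j\<in>J. A i j * y' j) = (\<Sum>j\<in>J - {s}. A i j * y j)" for i
      using s(1) fin by (simp add: sum.remove y'_def)
    define a where "a = (\<Sum>j\<in>J - {s}. A w j * y j)"
    define z where "z j = y' j - a / b * x j" for j
    have "(\<Sum>j\<in>J. A i j * z j) = (\<Sum>j\<in>J. A i j * y' j) - a / b * (\<Sum>j\<in>J. A i j * x j)" for i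
      by (simp add: z_def sum_subtractf sum_distrib_left algebra_simps)
    then have "(\<Sum>j\<in>J. A i j * z j) = 0" if "i \<in> I" for i
      using that x(1) y y' b by (cases "i = w") (simp_all flip: a_def b_def)
    then have z: "z k = 0" if "k \<in> J" for k using independent_columnsD[OF ind _ that] by blast
    \<comment> \<open>At \<open>s\<close> the vector \<open>y'\<close> vanishes but \<open>x\<close> does not, so the multiple of \<open>x\<close> is zero.\<close>
    have "a = 0" using z[OF s(1)] s(2) b by (simp add: z_def y'_def)
    then show "y j = 0" using z[of j] j by (simp add: z_def y'_def)
  qed
  then show ?thesis using s(1) by blast
qed

lemma independent_columns_subset_rows:
  assumes "finite I" "finite J" "card I = card J" "independent_columns A I J" "W \<subseteq> I"
  shows "\<exists>S\<subseteq>J. card S = card W \<and> independent_columns A W S"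
  using assms
proof (induction "card (I - W)" arbitrary: I J)
  case 0
  then have "W = I" by auto
  then show ?case using 0 by auto
next
  case (Suc k)
  then obtain w where w: "w \<in> I - W" by (metis card.empty ex_in_conv nat.distinct(1))
  then obtain s where s: "s \<in> J" "independent_columns A (I - {w}) (J - {s})"
    using independent_columns_delete_row[OF Suc.prems(1-4)] by blast
  have "I - {w} - W = (I - W) - {w}" by blast
  then have "k = card (I - {w} - W)" using Suc.hyps(2) w Suc.prems(1) by simp
  then obtain S where "S \<subseteq> J - {s}" "card S = card W" "independent_columns A W S"
    using Suc.hyps(1)[of "I - {w}" "J - {s}"] Suc.prems s w by auto
  then show ?case by blast
qed

section \<open>Trivial kernels and determinants\<close>

lemma bij_betw_pick:
  assumes "finite I"
  shows "bij_betw (pick I) {..<card I} I"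
proof -
  have "inj_on (pick I) {..<card I}"
  proof (rule inj_onI)
    fix a b assume "a \<in> {..<card I}" "b \<in> {..<card I}" "pick I a = pick I b"
    then show "a = b" by (metis card_pick_le lessThan_iff)
  qed
  moreover have "pick I ` {..<card I} \<subseteq> I" by (auto simp: pick_in_set_le)
  ultimately show ?thesis
    by (metis assms bij_betw_def card_image card_lessThan card_subset_eq)
qed

lemma det_submatrix_nonzero:
  fixes U :: "'a::field mat"
  assumes U: "U \<in> carrier_mat nr nc" and W: "W \<subseteq> {..<nr}" and S: "S \<subseteq> {..<nc}"
    and card: "card W = card S" and ind: "independent_columns (\<lambda>i j. U $$ (i, j)) W S"
  shows "det (submatrix U W S) \<noteq> 0"
proof
  let ?m = "card S"
  assume det: "det (submatrix U W S) = 0"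
  have eqs: "{i. i < dim_row U \<and> i \<in> W} = W" "{j. j < dim_col U \<and> j \<in> S} = S"
    using U W S by auto
  have fin: "finite W" "finite S" using W S finite_subset by auto
  have sub: "submatrix U W S \<in> carrier_mat ?m ?m"
    using dim_submatrix[of U W S] card by (auto simp: eqs)
  obtain v where v: "v \<in> carrier_vec ?m" "v \<noteq> 0\<^sub>v ?m" "submatrix U W S *\<^sub>v v = 0\<^sub>v ?m"
    using det det_0_iff_vec_prod_zero[OF sub] by auto
  define c where "c j = v $ the_inv_into {..<?m} (pick S) j" for j
  note pS = bij_betw_pick[OF fin(2)] and pW = bij_betw_pick[OF fin(1)]
  have c_pick: "c (pick S b) = v $ b" if "b < ?m" for b
    using that pS by (simp add: c_def the_inv_into_f_f bij_betw_def)
  have "(\<Sum>j\<in>S. U $$ (i, j) * c j) = 0" if "i \<in> W" for i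
  proof -
    obtain a where a: "a < ?m" "i = pick W a"
      using \<open>i \<in> W\<close> pW card by (force simp: bij_betw_def)
    have "(\<Sum>j\<in>S. U $$ (i, j) * c j) = (\<Sum>b<?m. U $$ (i, pick S b) * c (pick S b))"
      using sum.reindex_bij_betw[OF pS, of "\<lambda>j. U $$ (i, j) * c j"] by simp
    also have "\<dots> = (\<Sum>b<?m. submatrix U W S $$ (a, b) * v $ b)"
      using a card by (intro sum.cong) (auto simp: submatrix_index eqs c_pick)
    also have "\<dots> = (submatrix U W S *\<^sub>v v) $ a"
      using a sub v(1) by (simp add: scalar_prod_def lessThan_atLeast0)
    also have "\<dots> = 0" using v(3) a by simp
    finally show ?thesis .
  qed
  then have zero: "c j = 0" if "j \<in> S" for j using independent_columnsD[OF ind _ that] by blast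
  have "v = 0\<^sub>v ?m"
  proof (rule eq_vecI)
    fix b assume "b < dim_vec (0\<^sub>v ?m)"
    then show "v $ b = 0\<^sub>v ?m $ b" using c_pick[of b] zero[of "pick S b"] pick_in_set_le by auto
  qed (use v in auto)
  then show False using v(2) by blast
qed

lemma eigenvector_matrix_independent:
  assumes "eigenvector_matrix n A ev U"
  shows "independent_columns (\<lambda>i j. U $$ (i, j)) {..<n} {..<n}"
proof (rule independent_columnsI)
  fix c j
  assume c: "\<And>i. i \<in> {..<n} \<Longrightarrow> (\<Sum>j<n. U $$ (i, j) * c j) = 0" and j: "j \<in> {..<n}"
  interpret vec_space "TYPE('a)" n .
  have U: "U \<in> carrier_mat n n" "distinct (cols U)" "basis (set (cols U))"
    using assms unfolding eigenvector_matrix_def by auto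
  then have "rank U = n" using lin_indpt_full_rank[of U n] unfolding basis_def by blast
  then have det: "det U \<noteq> 0" using det_rank_iff[OF U(1)] by blast
  have "U *\<^sub>v vec n c = 0\<^sub>v n"
    by (rule eq_vecI) (use U(1) c in \<open>auto simp: scalar_prod_def lessThan_atLeast0\<close>)
  then have "vec n c = 0\<^sub>v n" 
    using det det_0_iff_vec_prod_zero[OF U(1)] vec_carrier by blast
  then show "c j = 0" using j by (metis index_vec index_zero_vec(1) lessThan_iff)
qed

section \<open>Galois conjugation of eigenvectors\<close>

text \<open>
  Eigenspaces are lines when a basis of eigenvectors has distinct eigenvalues. The basis together
  with \<open>v\<close> is one vector too many, so there is a relation between them; applying \<open>A - ev q\<close> to it
  kills \<open>v\<close> and the \<open>q\<close>-th basis vector and leaves a relation between the other basis vectors.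
\<close>

lemma eigenvectors_same_eigenvalue_proportional:
  fixes A :: "'i \<Rightarrow> 'i \<Rightarrow> 'a::field"
  assumes fin: "finite I" "finite J" and card: "card I = card J"
    and ind: "independent_columns u I J"
    and eig: "\<And>i j. i \<in> I \<Longrightarrow> j \<in> J \<Longrightarrow> (\<Sum>k\<in>I. A i k * u k j) = ev j * u i j"
    and inj: "inj_on ev J" and q: "q \<in> J"
    and v: "\<And>i. i \<in> I \<Longrightarrow> (\<Sum>k\<in>I. A i k * v k) = ev q * v i"
    and nz: "\<exists>i\<in>I. v i \<noteq> 0"
  shows "\<exists>d. d \<noteq> 0 \<and> (\<forall>i\<in>I. v i = d * u i q)"
proof -
  \<comment> \<open>The extra vector \<open>v\<close> is the column with index \<open>None\<close>.\<close>
  define B where "B i = case_option (v i) (u i)" for i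
  define J' where "J' = insert None (Some ` J)"
  have J': "finite J'" "card I < card J'"
    using fin card by (auto simp: J'_def card_image)
  obtain x where x: "\<forall>i\<in>I. (\<Sum>j\<in>J'. B i j * x j) = 0" "\<exists>j\<in>J'. x j \<noteq> 0"
    using underdetermined_homogeneous_system[OF fin(1) J', of B] by blast
  define e where "e = x None"
  define c where "c j = x (Some j)" for j
  have rel: "(\<Sum>j\<in>J. u i j * c j) + v i * e = 0" if "i \<in> I" for i
  proof -
    have "(\<Sum>j\<in>J'. B i j * x j) = v i * e + (\<Sum>j\<in>J. u i j * c j)"
      using fin unfolding J'_def
      by (subst sum.insert) (auto simp: B_def c_def e_def sum.reindex)
    then show ?thesis using x(1) that by (simp add: add.commute)
  qed
  have "(\<Sum>j\<in>J. u i j * ((ev j - ev q) * c j)) = 0" if i: "i \<in> I" for i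
  proof -
    have "0 = (\<Sum>k\<in>I. A i k * ((\<Sum>j\<in>J. u k j * c j) + v k * e))" using rel by simp
    also have "\<dots> = (\<Sum>k\<in>I. \<Sum>j\<in>J. A i k * u k j * c j) + (\<Sum>k\<in>I. A i k * v k) * e"
      by (simp add: distrib_left sum.distrib sum_distrib_left sum_distrib_right mult.assoc)
    also have "(\<Sum>k\<in>I. \<Sum>j\<in>J. A i k * u k j * c j) = (\<Sum>j\<in>J. (\<Sum>k\<in>I. A i k * u k j) * c j)"
      by (subst sum.swap) (simp add: sum_distrib_right)
    also have "\<dots> = (\<Sum>j\<in>J. ev j * u i j * c j)" using eig i by (intro sum.cong) auto
    finally have "(\<Sum>j\<in>J. ev j * u i j * c j) + ev q * (v i * e) = 0"
      using v[OF i] by (simp add: mult.assoc)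
    moreover have "ev q * (\<Sum>j\<in>J. u i j * c j) + ev q * (v i * e) = 0"
      using rel[OF i] by (metis distrib_left mult_zero_right)
    ultimately have "(\<Sum>j\<in>J. ev j * u i j * c j) - ev q * (\<Sum>j\<in>J. u i j * c j) = 0"
      by (metis add_right_cancel diff_self)
    then show ?thesis by (simp add: sum_subtractf sum_distrib_left algebra_simps)
  qed
  then have "(ev j - ev q) * c j = 0" if "j \<in> J" for j
    using independent_columnsD[OF ind, of "\<lambda>j. (ev j - ev q) * c j", OF _ that] by blast
  then have c0: "c j = 0" if "j \<in> J" "j \<noteq> q" for j
    using that inj q by (metis eq_iff_diff_eq_0 inj_on_contraD mult_eq_0_iff)
  have sumc: "(\<Sum>j\<in>J. u i j * c j) = u i q * c q" for i
    using q fin c0 by (simp add: sum.remove)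
  have e: "e \<noteq> 0"
  proof
    assume "e = 0"
    then have "c j = 0" if "j \<in> J" for j
      using independent_columnsD[OF ind _ that, of c] rel by auto
    then show False using x(2) \<open>e = 0\<close> by (auto simp: J'_def c_def e_def)
  qed
  have vq: "v i = - c q / e * u i q" if "i \<in> I" for i
    using rel[OF that] e unfolding sumc by (simp add: field_simps add_eq_0_iff)
  then have "- c q / e \<noteq> 0" using nz by (metis mult_zero_left)
  with vq show ?thesis by blast
qed

text \<open>
  If \<open>\<sigma>\<close> permutes columns up to scalars, it maps the kernel of the submatrix on \<open>S\<close> into the kernel
  of the submatrix on \<open>q ` S\<close>, after rescaling coordinates.
\<close>

lemma independent_columns_conjugate:
  assumes \<sigma>: "field_hom \<sigma>" and inj: "inj_on q S"
    and u: "\<And>i j. i \<in> W \<Longrightarrow> j \<in> S \<Longrightarrow> \<sigma> (u i j) = d j * u i (q j)"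
    and d: "\<And>j. j \<in> S \<Longrightarrow> d j \<noteq> 0"
    and ind: "independent_columns u W (q ` S)"
  shows "independent_columns u W S"
proof (rule independent_columnsI)
  interpret field_hom \<sigma> by fact
  fix c j
  assume c: "\<And>i. i \<in> W \<Longrightarrow> (\<Sum>j\<in>S. u i j * c j) = 0" and j: "j \<in> S"
  define c' where "c' k = (let j = the_inv_into S q k in d j * \<sigma> (c j))" for k
  have c': "c' (q j) = d j * \<sigma> (c j)" if "j \<in> S" for j
    using that inj by (simp add: c'_def the_inv_into_f_f)
  have "(\<Sum>k\<in>q ` S. u i k * c' k) = 0" if i: "i \<in> W" for i
  proof -
    have "(\<Sum>k\<in>q ` S. u i k * c' k) = (\<Sum>j\<in>S. \<sigma> (u i j) * \<sigma> (c j))"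
      using inj i by (auto simp: sum.reindex c' u intro!: sum.cong)
    also have "\<dots> = \<sigma> (\<Sum>j\<in>S. u i j * c j)" by (simp add: hom_distribs)
    also have "\<dots> = 0" using c[OF i] by simp
    finally show ?thesis .
  qed
  then have "c' (q j) = 0" using independent_columnsD[OF ind, of c' "q j"] j by blast
  then show "c j = 0" using c'[OF j] d[OF j] by simp
qed

section \<open>Transitivity on subsets\<close>

lemma symmetric_transitive_on_subsets:
  assumes fin: "finite R" and T: "T \<subseteq> R" "T' \<subseteq> R" and card: "card T = card T'"
  shows "\<exists>p. p permutes R \<and> p ` T = T'"
proof -
  have fT: "finite T" "finite T'" using fin T finite_subset by auto
  obtain f where f: "bij_betw f T T'"
    using finite_same_card_bij[OF fT card] by blast
  have "card (R - T) = card (R - T')" using fT T card by (simp add: card_Diff_subset)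
  then obtain g where g: "bij_betw g (R - T) (R - T')"
    using finite_same_card_bij[of "R - T" "R - T'"] fin by auto
  define p where "p x = (if x \<in> T then f x else if x \<in> R then g x else x)" for x
  have "bij_betw p T T'" using f by (rule bij_betw_cong[THEN iffD1, rotated]) (simp add: p_def)
  moreover have "bij_betw p (R - T) (R - T')"
    using g by (rule bij_betw_cong[THEN iffD1, rotated]) (simp add: p_def)
  ultimately have "bij_betw p (T \<union> (R - T)) (T' \<union> (R - T'))"
    by (rule bij_betw_combine) auto
  then have "bij_betw p R R" using T by (simp add: Un_absorb1)
  moreover have "p x = x" if "x \<notin> R" for x using that T by (auto simp: p_def)
  ultimately have "p permutes R" by (rule bij_imp_permutes)
  moreover have "p ` T = T'" using \<open>bij_betw p T T'\<close> by (rule bij_betw_imp_surj_on)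
  ultimately show ?thesis by blast
qed

text \<open>
  An odd permutation exists only on two or more points, hence here on at least three. Among three
  points two lie on the same side of the partition of \<open>R\<close> into \<open>T\<close> and its complement;
  precomposing with their transposition changes the parity without changing the image of \<open>T\<close>.
\<close>

lemma alternating_transitive_on_subsets:
  assumes fin: "finite R" and R: "card R \<noteq> 2"
    and T: "T \<subseteq> R" "T' \<subseteq> R" and card: "card T = card T'"
  shows "\<exists>p \<in> alt_perms R. p ` T = T'"
proof -
  obtain p where p: "p permutes R" "p ` T = T'"
    using symmetric_transitive_on_subsets[OF fin T card] by blast
  show ?thesis
  proof (cases "evenperm p")
    case True
    then show ?thesis using p by (auto simp: alt_perms_def)
  next
    case odd: False
    have "\<not> card R \<le> 1"
    proof
      assume "card R \<le> 1"
      then obtain a where "R \<subseteq> {a}"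
        using card_le_Suc0_iff_eq[OF fin] by (cases "R = {}") auto
      then have "p permutes {a}" using p(1) permutes_subset by blast
      then show False using odd by simp
    qed
    then have "3 \<le> card R" using R by linarith
    then have "2 \<le> card T \<or> 2 \<le> card (R - T)"
      using fin T(1) card_Diff_subset[of T R] finite_subset[OF T(1) fin] by linarith
    then obtain X where X: "2 \<le> card X" "X = T \<or> X = R - T" by blast
    obtain Y where "Y \<subseteq> X" "card Y = 2" using X(1) obtain_subset_with_card_n by metis
    then obtain a b where ab: "a \<noteq> b" "{a, b} \<subseteq> T \<or> {a, b} \<subseteq> R - T"
      using X(2) by (auto simp: card_2_iff)
    have tR: "transpose a b permutes R" using ab T by (intro permutes_swap_id) auto
    have "transpose a b ` T = T"
      using ab(2)
    proof
      assume "{a, b} \<subseteq> R - T"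
      then have "transpose a b x = x" if "x \<in> T" for x
        using that by (auto intro: transpose_apply_other)
      then show ?thesis by simp
    qed (use permutes_image[OF permutes_swap_id] in simp)
    then have "(p \<circ> transpose a b) ` T = T'" using p(2) by (simp only: image_comp[symmetric])
    moreover have "evenperm (p \<circ> transpose a b)"
      using evenperm_comp[of p "transpose a b"] permutes_imp_permutation[OF fin] p(1) tR odd ab(1)
      by (simp add: evenperm_swap)
    ultimately show ?thesis
      using permutes_compose[OF tR p(1)] by (auto simp: alt_perms_def)
  qed
qed

section \<open>Nonvanishing minors\<close>

theorem theorem2:
  fixes h :: "'k::field \<Rightarrow> 'l::field"
    and M :: "'k mat"
    and U :: "'l mat"
    and ev :: "nat \<Rightarrow> 'l"
    and n :: nat
  assumes M: "M \<in> carrier_mat n n"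
    and splitting: "is_splitting_field h (char_poly M)"
    and diag: "diagonalizable_mat (map_mat h M)"
    and eigenvalues: "map_poly h (char_poly M) = (\<Prod>i<n. [:- ev i, 1:])"
    and distinct_roots: "inj_on ev {..<n}"
    and U: "eigenvector_matrix n (map_mat h M) ev U"
    and gal: "alt_perms (roots_in h (char_poly M)) \<subseteq> gal_perms h (char_poly M)"
    and gal_two: "n = 2 \<Longrightarrow> gal_perms h (char_poly M) = sym_perms (roots_in h (char_poly M))"
  shows "\<forall>m W S. 1 \<le> m \<and> m \<le> n \<and> W \<subseteq> {..<n} \<and> S \<subseteq> {..<n} \<and> card W = m \<and> card S = m
           \<longrightarrow> det (submatrix U W S) \<noteq> 0"
proof (intro allI impI, elim conjE)
  fix m W S
  assume W: "W \<subseteq> {..<n}" "card W = m" and S: "S \<subseteq> {..<n}" "card S = m"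
  define R where "R = roots_in h (char_poly M)"
  have R: "R = ev ` {..<n}"
    by (auto simp: R_def roots_in_def eigenvalues poly_prod)
  have finR: "finite R" and cardR: "card R = n"
    using distinct_roots by (auto simp: R card_image)
  define u where "u i j = U $$ (i, j)" for i j
  have ind: "independent_columns u {..<n} {..<n}"
    using eigenvector_matrix_independent[OF U] by (simp add: u_def[abs_def])
  have Uc: "U \<in> carrier_mat n n" using U by (simp add: eigenvector_matrix_def)
  have col: "col U j $ i = u i j" if "i < n" "j < n" for i j using Uc that by (simp add: u_def)
  have eigv: "eigenvector (map_mat h M) (col U j) (ev j)" if "j < n" for j
    using U that by (simp add: eigenvector_matrix_def)
  have eig: "(\<Sum>k<n. h (M $$ (i, k)) * u k j) = ev j * u i j" if ij: "i < n" "j < n" for i j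
  proof -
    have "(map_mat h M *\<^sub>v col U j) $ i = (ev j \<cdot>\<^sub>v col U j) $ i"
      using eigv[OF ij(2)] by (simp add: eigenvector_def)
    then show ?thesis using M Uc ij by (simp add: scalar_prod_def lessThan_atLeast0 u_def)
  qed
  have nz: "\<exists>i<n. u i j \<noteq> 0" if j: "j < n" for j
  proof (rule ccontr)
    assume "\<not> ?thesis"
    then have "col U j = 0\<^sub>v n" using Uc j col by (intro eq_vecI) auto
    then show False using eigv[OF j] M by (simp add: eigenvector_def)
  qed
  obtain S0 where S0: "S0 \<subseteq> {..<n}" "card S0 = m" "independent_columns u W S0"
    using independent_columns_subset_rows[OF _ _ _ ind W(1)] W(2) by auto
  have T: "ev ` S \<subseteq> R" "ev ` S0 \<subseteq> R" "card (ev ` S) = card (ev ` S0)"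
    using S S0 distinct_roots by (auto simp: R card_image inj_on_subset)
  have "\<exists>p \<in> gal_perms h (char_poly M). p ` ev ` S = ev ` S0"
  proof (cases "n = 2")
    case True
    then show ?thesis using symmetric_transitive_on_subsets[OF finR T] gal_two
      by (auto simp: sym_perms_def R_def)
  next
    case False
    then show ?thesis using alternating_transitive_on_subsets[OF finR _ T] cardR gal
      by (auto simp: R_def)
  qed
  then obtain \<sigma> where \<sigma>: "\<sigma> \<in> gal_group h" "perm_restrict \<sigma> R ` ev ` S = ev ` S0"
    by (auto simp: gal_perms_def R_def)
  have \<sigma>S: "\<sigma> ` ev ` S = ev ` S0"
    using \<sigma>(2) T(1) by (metis (no_types, lifting) image_cong perm_restrict_simps(1) subset_iff)
  have hom: "field_hom \<sigma>" and \<sigma>h: "\<And>a. \<sigma> (h a) = h a" using \<sigma>(1) by (auto simp: gal_group_def)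
  interpret \<sigma>: field_hom \<sigma> by fact
  \<comment> \<open>\<open>q\<close> is the action of \<open>\<sigma>\<close> on the eigenvalues, read on their indices in \<open>S\<close>.\<close>
  have "\<forall>j\<in>S. \<exists>k\<in>S0. \<sigma> (ev j) = ev k" using \<sigma>S by blast
  then obtain q where q: "\<And>j. j \<in> S \<Longrightarrow> q j \<in> S0" "\<And>j. j \<in> S \<Longrightarrow> \<sigma> (ev j) = ev (q j)" by metis
  have injq: "inj_on q S"
    using q(2) distinct_roots S(1) by (intro inj_onI) (metis \<sigma>.eq_iff inj_onD subset_iff)
  have finS0: "finite S0" using S0(1) finite_subset by blast
  have qS: "q ` S = S0"
    by (rule card_subset_eq[OF finS0]) (use q(1) injq S S0 in \<open>auto simp: card_image\<close>)
  have "\<exists>d. d \<noteq> 0 \<and> (\<forall>i\<in>{..<n}. \<sigma> (u i j) = d * u i (q j))" if j: "j \<in> S" for j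
  proof (rule eigenvectors_same_eigenvalue_proportional[where A = "\<lambda>i k. h (M $$ (i, k))"
        and ev = ev and J = "{..<n}"])
    have jn: "j < n" using j S by auto
    show "q j \<in> {..<n}" using q(1)[OF j] S0 by auto
    show "\<exists>i\<in>{..<n}. \<sigma> (u i j) \<noteq> 0" using nz[OF jn] by auto
    fix i assume "i \<in> {..<n}"
    then have "\<sigma> (\<Sum>k<n. h (M $$ (i, k)) * u k j) = \<sigma> (ev j * u i j)" using eig jn by simp
    then show "(\<Sum>k<n. h (M $$ (i, k)) * \<sigma> (u k j)) = ev (q j) * \<sigma> (u i j)"
      by (simp add: \<sigma>.hom_sum \<sigma>.hom_mult \<sigma>h q(2)[OF j])
  qed (use ind eig distinct_roots in auto)
  then obtain d where d: "\<And>j. j \<in> S \<Longrightarrow> d j \<noteq> 0"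
      "\<And>i j. j \<in> S \<Longrightarrow> i < n \<Longrightarrow> \<sigma> (u i j) = d j * u i (q j)"
    by (metis lessThan_iff)
  have "independent_columns u W S"
    by (rule independent_columns_conjugate[OF hom injq, where d = d]) (use d W qS S0 in auto)
  then show "det (submatrix U W S) \<noteq> 0"
    using det_submatrix_nonzero[OF Uc W(1) S(1)] W S by (simp add: u_def[abs_def])
qed

end
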